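(* Let $N\ge2$, $0<g_1<\cdots<g_N$, $f_{ij}=g_i+g_j$ for $i\ne j$. Let $y$ be a sufficiently smooth composition field (function of time and of $x$ in a domain of $\mathbb R^d$) with values in $\overline{\mathcal S}=\{y\in[0,1]^N:\sum_iy_i=1\}$, let $J=(J_1,\dots,J_N)^{\sf T}$, $J_i\in\mathbb R^d$, satisfy $\sum_iJ_i=0$ and $\nabla y=B(y)J$, and let $U=(U_\ell)_{\ell=1}^{N-1}$, $U_\ell=\sum_ig_i^\ell y_i$, be its moment vector. Then the moment flux $F=(F_\ell)_{\ell=1}^{N-1}$, $F_\ell=\sum_{i=1}^Ng_i^\ell J_i$, satisfies $$F=-A_N(U)\nabla U.$$ If the species balances $\partial_ty_i+\operatorname{div}J_i=0$, $i=1,\dots,N$, hold, then $$\partial_tU-\operatorname{div}\bigl(A_N(U)\nabla U\bigr)=0.$$ Moreover, $A_N$ extends real-analytically to a neighbourhood (in $\mathbb R^{N-1}$) of the closed moment simplex $\mathcal T$ and remains invertible there.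
   Context: $B(y)$ is the matrix $B_{ij}(y)=y_if_{ij}$ ($i\ne j$), $B_{ii}(y)=-\sum_{\ell\ne i}f_{i\ell}y_\ell$; $\nabla y=B(y)J$ means $\partial_{x_k}y=B(y)J^k$ for each column $J^k\in\mathbb R^N$ of $J$, $k=1,\dots,d$; similarly $A_N(U)$ acts on component indices. $E=\{v\in\mathbb R^N:\sum_iv_i=0\}$; $B(y)|_E:E\to E$ is invertible for every $y\in\overline{\mathcal S}$. $\mathcal T=\operatorname{co}\{(g_i,g_i^2,\dots,g_i^{N-1})^{\sf T}:i=1,\dots,N\}$; the moment map $y\mapsto U$ is an affine bijection $\overline{\mathcal S}\to\mathcal T$ with inverse $y(U)$. $\mathsf L:E\to\mathbb R^{N-1}$, $\mathsf Lv=(\sum_ig_i^\ell v_i)_{\ell=1}^{N-1}$, is an isomorphism, $\mathsf R=\mathsf L^{-1}$, and $A_N(U):=-\mathsf L\bigl(B(y(U))|_E\bigr)^{-1}\mathsf R$ for $U\in\mathcal T$. *)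

theory Defs
  imports "HOL-Analysis.Analysis"
begin

text \<open>
  The species are indexed by a finite linearly ordered type \<open>'n\<close> with \<open>N = CARD('n)\<close>, the moments by a
  finite linearly ordered type \<open>'m\<close> with \<open>N - 1\<close> elements.  Thus vectors in \<open>R^N\<close> and
  \<open>R^(N-1)\<close> have types \<open>real^'n\<close> and \<open>real^'m\<close>, and a family of \<open>N\<close> vectors of \<open>R^d\<close> is a
  matrix \<open>real^'d^'n\<close> with row \<open>J $ i\<close> for the \<open>i\<close>-th vector.
\<close>

text \<open>
  The exponent belonging to a moment index is its position \<open>1, ..., N - 1\<close> in the order of \<open>'m\<close>.
\<close>

definition moment_degree :: "'m::{finite,linorder} \<Rightarrow> nat" where
  "moment_degree l = card {k. k \<le> l}"

definition moment_map :: "real^'n::{finite,linorder} \<Rightarrow> real^'n::{finite,linorder} \<Rightarrow> real^'m::{finite,linorder}" where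
  "moment_map g v = (\<chi> l. \<Sum>i\<in>UNIV. (g $ i) ^ moment_degree l * v $ i)"

definition closed_composition_simplex :: "(real^'n::finite) set" where
  "closed_composition_simplex =
     {y. (\<forall>i. 0 \<le> y $ i \<and> y $ i \<le> 1) \<and> (\<Sum>i\<in>UNIV. y $ i) = 1}"

definition zero_sum_space :: "(real^'n::finite) set" where
  "zero_sum_space = {v. (\<Sum>i\<in>UNIV. v $ i) = 0}"

definition moment_simplex :: "real^'n::{finite,linorder} \<Rightarrow> (real^'m::{finite,linorder}) set" where
  "moment_simplex g = convex hull (range (\<lambda>i. \<chi> l. (g $ i) ^ moment_degree l))"

definition MS_matrix :: "('n \<Rightarrow> 'n \<Rightarrow> real) \<Rightarrow> real^'n::finite \<Rightarrow> real^'n^'n" where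
  "MS_matrix f y =
     (\<chi> i j. if i = j then - (\<Sum>l\<in>UNIV - {i}. f i l * y $ l) else y $ i * f i j)"

text \<open>
  The inverses \<open>y(U)\<close>, \<open>(B(y)|E)^(-1)\<close> and \<open>R = L^(-1)\<close> are inverses of maps restricted to the closed
  simplex, to \<open>E\<close> and to \<open>E\<close>.  The maps \<open>y \<mapsto> U\<close> and \<open>L\<close> are given by the same formula
  \<open>moment_map g\<close> on different domains.
\<close>

definition composition_of_moments ::
    "real^'n::{finite,linorder} \<Rightarrow> real^'m::{finite,linorder} \<Rightarrow> real^'n::{finite,linorder}" where
  "composition_of_moments g = the_inv_into closed_composition_simplex (moment_map g)"

definition MS_inverse :: "('n \<Rightarrow> 'n \<Rightarrow> real) \<Rightarrow> real^'n::finite \<Rightarrow> real^'n \<Rightarrow> real^'n" where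
  "MS_inverse f y = the_inv_into zero_sum_space (\<lambda>v. MS_matrix f y *v v)"

definition moment_lift ::
    "real^'n::{finite,linorder} \<Rightarrow> real^'m::{finite,linorder} \<Rightarrow> real^'n::{finite,linorder}" where
  "moment_lift g = the_inv_into zero_sum_space (moment_map g)"

text \<open>The operator \<open>A_N(U) = - L (B(y(U))|E)^(-1) R\<close> as a matrix in the standard basis.\<close>

definition moment_diffusion_matrix ::
    "('n \<Rightarrow> 'n \<Rightarrow> real) \<Rightarrow> real^'n::{finite,linorder} \<Rightarrow> real^'m::{finite,linorder} \<Rightarrow> real^'m::{finite,linorder}^'m::{finite,linorder}" where
  "moment_diffusion_matrix f g U =
     matrix (\<lambda>w. - moment_map g (MS_inverse f (composition_of_moments g U) (moment_lift g w)))"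

text \<open>
  Spatial gradients of vector fields are the library's \<open>jacobian\<close>, whose \<open>(i, k)\<close> entry is the
  \<open>k\<close>-th partial derivative of the \<open>i\<close>-th component.
\<close>

definition divergence :: "(real^'d \<Rightarrow> real^'d) \<Rightarrow> real^'d::finite \<Rightarrow> real" where
  "divergence V x = trace (jacobian V (at x))"

definition row_divergence :: "(real^'d \<Rightarrow> real^'d^'m) \<Rightarrow> real^'d::finite \<Rightarrow> real^'m::finite" where
  "row_divergence M x = (\<chi> l. divergence (\<lambda>z. M z $ l) x)"

definition moment_flux ::
    "real^'n::{finite,linorder} \<Rightarrow> real^'d^'n::{finite,linorder} \<Rightarrow> real^'d::finite^'m::{finite,linorder}" where
  "moment_flux g J = (\<chi> l. \<Sum>i\<in>UNIV. (g $ i) ^ moment_degree l *\<^sub>R J $ i)"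

text \<open>
  Real analyticity in several variables: near each point, \<open>f\<close> is the (unconditional) sum of a power
  series; the index \<open>\<alpha> :: 'm \<Rightarrow> nat\<close> runs over all multi-indices.
\<close>

definition real_analytic_on :: "(real^'m::finite \<Rightarrow> 'b::real_normed_vector) \<Rightarrow> (real^'m) set \<Rightarrow> bool" where
  "real_analytic_on f S \<longleftrightarrow>
     (\<forall>a\<in>S. \<exists>r>0. \<exists>c :: ('m \<Rightarrow> nat) \<Rightarrow> 'b. \<forall>x\<in>ball a r.
        ((\<lambda>\<alpha>. (\<Prod>i\<in>UNIV. (x $ i - a $ i) ^ \<alpha> i) *\<^sub>R c \<alpha>) has_sum f x) UNIV)"

end

theory Submission
  imports Defs
begin

text \<open>
  Since \<open>f\<^sub>i\<^sub>j = g\<^sub>i + g\<^sub>j\<close>, on \<open>E\<close> the matrix \<open>B(y)\<close> is a diagonal matrix plus a rank-one term, and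
  \<open>B(y) v = w\<close> is solved explicitly by \<open>v\<^sub>i = (y\<^sub>i q - w\<^sub>i) / (g\<^sub>i + m)\<close> with \<open>m = \<Sum>\<^sub>j g\<^sub>j y\<^sub>j\<close> and \<open>q\<close> fixed
  by \<open>\<Sum>\<^sub>i v\<^sub>i = 0\<close>.  The matrix \<open>C(U) = - L B(y(U)) R\<close> is affine in \<open>U\<close> and inverse to \<open>A\<^sub>N(U)\<close> on the
  moment simplex, so \<open>\<nabla>U = L B J = - C(U) F\<close> gives \<open>F = - A\<^sub>N(U) \<nabla>U\<close>, and \<open>C(U)\<^sup>-\<^sup>1\<close> extends \<open>A\<^sub>N\<close> to the
  open set where \<open>det C \<noteq> 0\<close>.  Analyticity comes from the Neumann series: with increments \<open>h\<^sub>k\<close> and matrices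
  \<open>M\<^sub>k\<close>, the powers of \<open>\<Sum>\<^sub>k h\<^sub>k M\<^sub>k\<close> expand into an absolutely convergent sum over words in the letters \<open>k\<close>,
  and collecting the finitely many words with given letter counts yields the power series.
\<close>

section \<open>Analyticity of the inverse of an affine matrix function\<close>

lemma prod_list_map_count:
  fixes h :: "'m::finite \<Rightarrow> 'a::comm_monoid_mult"
  shows "prod_list (map h w) = (\<Prod>k\<in>UNIV. h k ^ count_list w k)"
proof (induction w)
  case (Cons a w)
  have "(\<Prod>k\<in>UNIV. h k ^ count_list (a # w) k)
      = (\<Prod>k\<in>UNIV. (if k = a then h k else 1) * h k ^ count_list w k)"
    by (rule prod.cong) auto
  also have "\<dots> = h a * (\<Prod>k\<in>UNIV. h k ^ count_list w k)"
    by (simp add: prod.distrib prod.delta)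
  finally show ?case using Cons by simp
qed simp

text \<open>The letter counts of a word add up to its length, so only words of one fixed length over
  a finite alphabet qualify.\<close>

lemma finite_count_list_eq:
  fixes \<alpha> :: "'m::finite \<Rightarrow> nat"
  shows "finite {w. count_list w = \<alpha>}"
proof (rule finite_subset)
  show "{w. count_list w = \<alpha>} \<subseteq> {w. set w \<subseteq> UNIV \<and> length w = sum \<alpha> UNIV}"
    using sum_count_set[of _ "UNIV :: 'm set"] by (auto simp: sum_count_set)
qed (rule finite_lists_length_eq, simp)

text \<open>The scalar factor depends on a word only through its letter counts. The words therefore
  split into the finite fibres of \<open>count_list\<close>, and the coefficients are added within
  each fibre.\<close>

lemma has_sum_words_to_multi_indices:
  fixes h :: "'m::finite \<Rightarrow> real" and c :: "'m list \<Rightarrow> 'b::real_normed_vector"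
  assumes "((\<lambda>w. prod_list (map h w) *\<^sub>R c w) has_sum S) UNIV"
  shows "((\<lambda>\<alpha>. (\<Prod>k\<in>UNIV. h k ^ \<alpha> k) *\<^sub>R (\<Sum>w | count_list w = \<alpha>. c w)) has_sum S) UNIV"
proof -
  let ?t = "\<lambda>w. prod_list (map h w) *\<^sub>R c w"
  let ?fib = "\<lambda>\<alpha>. {w::'m list. count_list w = \<alpha>}"
  have bij: "bij_betw snd (Sigma UNIV ?fib) (UNIV :: 'm list set)"
    by (auto simp: bij_betw_def inj_on_def image_iff)
  have "((\<lambda>p. ?t (snd p)) has_sum S) (Sigma UNIV ?fib)"
    using has_sum_reindex_bij_betw[OF bij, of ?t] assms by simp
  moreover have "((\<lambda>w. ?t (snd (\<alpha>, w))) has_sum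
      (\<Prod>k\<in>UNIV. h k ^ \<alpha> k) *\<^sub>R (\<Sum>w | count_list w = \<alpha>. c w)) (?fib \<alpha>)" for \<alpha>
  proof (rule has_sum_finiteI[OF finite_count_list_eq])
    show "(\<Prod>k\<in>UNIV. h k ^ \<alpha> k) *\<^sub>R (\<Sum>w | count_list w = \<alpha>. c w)
        = (\<Sum>w | count_list w = \<alpha>. ?t (snd (\<alpha>, w)))"
      by (auto simp: scaleR_sum_right prod_list_map_count intro!: sum.cong)
  qed
  ultimately show ?thesis
    by (rule has_sum_Sigma[OF isUCont_plus])
qed

text \<open>Let s be \<open>sum q UNIV\<close>. Splitting off the first letter shows that passing
  from length at most n to length at most n + 1 replaces the sum a by 1 + s a; the bound is the
  fixed point of this recursion.\<close>

lemma sum_words_le: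
  fixes q :: "'m::finite \<Rightarrow> real"
  assumes q: "\<And>k. 0 \<le> q k" and s: "sum q UNIV < 1" and F: "finite F"
  shows "(\<Sum>w\<in>F. prod_list (map q w)) \<le> 1 / (1 - sum q UNIV)"
proof -
  let ?s = "sum q UNIV"
  let ?W = "\<lambda>n. {w::'m list. length w \<le> n}"
  have nonneg: "0 \<le> prod_list (map q w)" for w
    by (induction w) (auto simp: q)
  have finW: "finite (?W n)" for n
    using finite_lists_length_le[of "UNIV :: 'm set" n] by simp
  have bound: "(\<Sum>w\<in>?W n. prod_list (map q w)) \<le> 1 / (1 - ?s)" for n
  proof (induction n)
    case 0
    have "?W 0 = {[]}" by auto
    then show ?case using s sum_nonneg[of UNIV q] q by (simp add: field_simps)
  next
    case (Suc n)
    let ?c = "\<lambda>(k, w). k # w"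
    have W: "?W (Suc n) = insert [] (?c ` (UNIV \<times> ?W n))"
    proof (intro set_eqI)
      fix w show "w \<in> ?W (Suc n) \<longleftrightarrow> w \<in> insert [] (?c ` (UNIV \<times> ?W n))"
        by (cases w) (auto simp: image_iff)
    qed
    have "(\<Sum>w\<in>?W (Suc n). prod_list (map q w))
        = 1 + (\<Sum>w\<in>?c ` (UNIV \<times> ?W n). prod_list (map q w))"
      unfolding W by (subst sum.insert) (auto simp: finW)
    also have "(\<Sum>w\<in>?c ` (UNIV \<times> ?W n). prod_list (map q w))
        = (\<Sum>(k, w)\<in>UNIV \<times> ?W n. q k * prod_list (map q w))"
      by (subst sum.reindex) (auto simp: inj_on_def intro!: sum.cong)
    also have "\<dots> = ?s * (\<Sum>w\<in>?W n. prod_list (map q w))"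
      by (simp add: sum_product sum.cartesian_product)
    also have "\<dots> \<le> ?s * (1 / (1 - ?s))"
      using Suc q by (intro mult_left_mono sum_nonneg) auto
    also have "1 + ?s * (1 / (1 - ?s)) = 1 / (1 - ?s)"
      using s by (simp add: field_simps)
    finally show ?case by simp
  qed
  obtain n where n: "\<And>w. w \<in> F \<Longrightarrow> length w \<le> n"
    using finite_nat_set_iff_bounded_le[of "length ` F"] F by auto
  have "(\<Sum>w\<in>F. prod_list (map q w)) \<le> (\<Sum>w\<in>?W n. prod_list (map q w))"
    using n nonneg finW by (intro sum_mono2) auto
  with bound[of n] show ?thesis by linarith
qed

lemma summable_on_words:
  fixes q :: "'m::finite \<Rightarrow> real"
  assumes "\<And>k. 0 \<le> q k" and "sum q UNIV < 1"
  shows "(\<lambda>w. prod_list (map q w)) summable_on UNIV"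
proof (rule nonneg_bdd_above_summable_on)
  show "0 \<le> prod_list (map q w)" for w
    by (induction w) (auto simp: assms)
  show "bdd_above (sum (\<lambda>w. prod_list (map q w)) ` {F. F \<subseteq> UNIV \<and> finite F})"
    using sum_words_le[OF assms] by (intro bdd_aboveI2) auto
qed

text \<open>A word is empty or has a unique first letter, so \<open>UNIV\<close> is a finite
  disjoint union. Applied to Neumann terms, this turns the sum over words into a fixed-point
  equation.\<close>

lemma has_sum_words_Cons:
  fixes t :: "'m::finite list \<Rightarrow> 'b::real_normed_vector"
  assumes "\<And>k. ((\<lambda>w. t (k # w)) has_sum s k) UNIV"
  shows "(t has_sum (t [] + sum s UNIV)) UNIV"
proof -
  have "(t has_sum sum s K) (\<Union>k\<in>K. range ((#) k))" if "finite K" for K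
    using that
  proof (induction K)
    case (insert k K)
    have "(t has_sum s k) (range ((#) k))"
      using assms[of k] by (subst has_sum_reindex) (auto simp: o_def)
    from has_sum_Un_disjoint[OF this insert.IH] insert.hyps show ?case
      by auto
  qed simp
  from this[of UNIV] have "(t has_sum sum s UNIV) (\<Union>k. range ((#) k))" by simp
  moreover have "(t has_sum t []) {[]}"
    using has_sum_finite[of "{[]}" t] by simp
  ultimately have "(t has_sum (t [] + sum s UNIV)) ({[]} \<union> (\<Union>k. range ((#) k)))"
    by (intro has_sum_Un_disjoint) auto
  moreover have "{[]} \<union> (\<Union>k. range ((#) k)) = (UNIV :: 'm list set)"
  proof (intro set_eqI)
    fix w :: "'m list"
    show "w \<in> {[]} \<union> (\<Union>k. range ((#) k)) \<longleftrightarrow> w \<in> UNIV"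
      by (cases w) auto
  qed
  ultimately show ?thesis by simp
qed

section \<open>The Neumann series over words\<close>

lemma bounded_bilinear_matrix_mult:
  "bounded_bilinear ((**) :: real^'b^'a \<Rightarrow> real^'c^'b \<Rightarrow> real^'c^'a)"
  unfolding bilinear_conv_bounded_bilinear[symmetric] bilinear_def
  by (auto intro!: linearI simp: vec_eq_iff matrix_matrix_mult_def sum.distrib ring_distribs sum_distrib_left mult_ac)

text \<open>The \<open>foldr\<close> is the product of the \<open>M k\<close> along the word, times
  \<open>B\<close>. The second conclusion says (1 - \<Sum>k. h k M k) S = B, and it is by this
  equation that the sum is later recognised as an inverse.\<close>

lemma matrix_Neumann_words:
  fixes h :: "'m::finite \<Rightarrow> real" and M :: "'m \<Rightarrow> real^'k^'k" and B :: "real^'k^'k"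
  assumes K: "\<And>(X :: real^'k^'k) (Y :: real^'k^'k). norm (X ** Y) \<le> norm X * norm Y * K" "0 < K"
    and small: "(\<Sum>k\<in>UNIV. \<bar>h k\<bar> * (norm (M k) * K)) < 1"
  obtains S where
    "((\<lambda>w. prod_list (map h w) *\<^sub>R foldr (\<lambda>k X. M k ** X) w B) has_sum S) UNIV"
    "S = B + (\<Sum>k\<in>UNIV. h k *\<^sub>R (M k ** S))"
proof -
  define t where "t w = prod_list (map h w) *\<^sub>R foldr (\<lambda>k X. M k ** X) w B" for w
  \<comment> \<open>\<open>q k\<close> bounds the factor by which prefixing the letter
    \<open>k\<close> changes the norm of a term; \<open>K\<close> stands in for submultiplicativity
    of the norm.\<close>
  define q where "q k = \<bar>h k\<bar> * (norm (M k) * K)" for k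
  have q: "0 \<le> q k" for k using K(2) by (simp add: q_def)
  have t_Cons: "t (k # w) = h k *\<^sub>R (M k ** t w)" for k w
    by (simp add: t_def bounded_bilinear.scaleR_right[OF bounded_bilinear_matrix_mult])
  have bound: "norm (t w) \<le> prod_list (map q w) * norm B" for w
  proof (induction w)
    case (Cons k w)
    have "norm (t (k # w)) \<le> \<bar>h k\<bar> * (norm (M k) * norm (t w) * K)"
      unfolding t_Cons norm_scaleR by (rule mult_left_mono[OF K(1)]) simp
    also have "\<dots> = q k * norm (t w)" by (simp add: q_def)
    also have "\<dots> \<le> q k * (prod_list (map q w) * norm B)"
      by (intro mult_left_mono Cons q)
    finally show ?case by (simp add: mult.assoc)
  qed (simp add: t_def)
  have nonneg: "0 \<le> prod_list (map q w)" for w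
    by (induction w) (auto simp: q)
  have "(\<lambda>w. prod_list (map q w) * norm B) summable_on UNIV"
    using summable_on_words[of q, OF q] small[folded q_def] by (intro summable_on_cmult_left)
  then have "(\<lambda>w. norm (prod_list (map q w) * norm B)) summable_on UNIV"
    using nonneg by (simp add: abs_mult)
  then have "(\<lambda>w. norm (t w)) summable_on UNIV"
    by (rule Infinite_Sum.abs_summable_on_comparison_test) (use bound nonneg in \<open>simp add: abs_mult\<close>)
  then obtain S where S: "(t has_sum S) UNIV"
    using Infinite_Sum.abs_summable_summable summable_on_def by blast
  \<comment> \<open>Prefixing a letter acts on the terms as a bounded linear map, so it passes
    through the infinite sum.\<close>
  have "((\<lambda>w. t (k # w)) has_sum (h k *\<^sub>R (M k ** S))) UNIV" for k
  proof -
    have "bounded_linear (\<lambda>X. h k *\<^sub>R (M k ** X))"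
      using bounded_linear_compose[OF bounded_linear_scaleR_right
        bounded_bilinear.bounded_linear_right[OF bounded_bilinear_matrix_mult]] .
    from has_sum_bounded_linear[OF this S] show ?thesis by (simp add: t_Cons o_def)
  qed
  from has_sum_words_Cons[of t, OF this]
  have "(t has_sum (B + (\<Sum>k\<in>UNIV. h k *\<^sub>R (M k ** S)))) UNIV" by (simp add: t_def)
  with S have "S = B + (\<Sum>k\<in>UNIV. h k *\<^sub>R (M k ** S))" by (rule has_sum_unique)
  with S show thesis using that[of S] unfolding t_def by blast
qed

section \<open>Matrix inverses as power series\<close>

lemma matrix_inv_unique:
  fixes A B :: "'a::field^'n^'n"
  assumes "A ** B = mat 1"
  shows "matrix_inv A = B" and "invertible A"
proof -
  have BA: "B ** A = mat 1" using assms matrix_left_right_inverse by blast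
  then show "invertible A" using assms by (auto simp: invertible_def)
  \<comment> \<open>\<open>matrix_inv\<close> is a choice among inverses, so uniqueness is what
    determines its value.\<close>
  have unique: "X = B" if "A ** X = mat 1" for X
  proof -
    have "X = (B ** A) ** X" by (simp only: BA matrix_mul_lid)
    also have "\<dots> = B" by (simp only: that matrix_mul_rid flip: matrix_mul_assoc)
    finally show ?thesis .
  qed
  show "matrix_inv A = B"
    unfolding matrix_inv_def
    by (rule some_equality) (simp_all only: assms BA unique simp_thms)
qed

lemma matrix_mul_inv:
  fixes A :: "'a::field^'n^'n"
  assumes "invertible A"
  shows "A ** matrix_inv A = mat 1" and "matrix_inv A ** A = mat 1"
proof -
  obtain B where "A ** B = mat 1" "B ** A = mat 1"
    using assms by (auto simp: invertible_def)
  then show "A ** matrix_inv A = mat 1" and "matrix_inv A ** A = mat 1"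
    by (simp_all only: matrix_inv_unique)
qed

text \<open>With \<open>B\<close> inverse to \<open>C\<^sub>0 + D a\<close>, the matrix
  \<open>C\<^sub>0 + D x\<close> factors as \<open>C\<^sub>0 + D a\<close> times 1 + B D(x - a). Its
  inverse is thus the Neumann series of - B D(x - a), multiplied by \<open>B\<close> on the
  right.\<close>

lemma real_analytic_on_matrix_inv_affine:
  fixes C\<^sub>0 :: "real^'k^'k" and D :: "real^'m \<Rightarrow> real^'k^'k"
  assumes D: "linear D"
  shows "real_analytic_on (\<lambda>V. matrix_inv (C\<^sub>0 + D V)) {V. invertible (C\<^sub>0 + D V)}"
  unfolding real_analytic_on_def
proof
  fix a assume "a \<in> {V. invertible (C\<^sub>0 + D V)}"
  then have inv: "invertible (C\<^sub>0 + D a)" by simp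
  define B where "B = matrix_inv (C\<^sub>0 + D a)"
  \<comment> \<open>\<open>M k\<close> is the coefficient of the k-th increment in - B D(x -
    a).\<close>
  define M where "M k = - (B ** D (axis k 1))" for k
  obtain K :: real where K: "K > 0" "\<And>(X :: real^'k^'k) (Y :: real^'k^'k). norm (X ** Y) \<le> norm X * norm Y * K"
    using bounded_bilinear.pos_bounded[OF bounded_bilinear_matrix_mult] by blast
  \<comment> \<open>The added 1 keeps the denominator positive and makes r times the sum strictly
    less than 1.\<close>
  define r where "r = 1 / ((\<Sum>k\<in>UNIV. norm (M k) * K) + 1)"
  have T: "0 \<le> (\<Sum>k\<in>UNIV. norm (M k) * K)" using K(1) by (intro sum_nonneg) auto
  then have r: "0 < r" by (simp add: r_def)
  define c where "c \<alpha> = (\<Sum>w | count_list w = \<alpha>. foldr (\<lambda>k X. M k ** X) w B)" for \<alpha>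
  have "((\<lambda>\<alpha>. (\<Prod>k\<in>UNIV. (x $ k - a $ k) ^ \<alpha> k) *\<^sub>R c \<alpha>) has_sum matrix_inv (C\<^sub>0 + D x)) UNIV"
    if x: "x \<in> ball a r" for x
  proof -
    define h where "h k = x $ k - a $ k" for k
    have h: "\<bar>h k\<bar> \<le> r" for k
      using x component_le_norm_cart[of "x - a" k] by (simp add: h_def dist_norm norm_minus_commute)
    have "(\<Sum>k\<in>UNIV. \<bar>h k\<bar> * (norm (M k) * K)) \<le> (\<Sum>k\<in>UNIV. r * (norm (M k) * K))"
      using K(1) h by (intro sum_mono mult_right_mono) auto
    also have "\<dots> = r * (\<Sum>k\<in>UNIV. norm (M k) * K)"
      by (simp add: sum_distrib_left)
    also have "\<dots> < 1"
      using T by (simp add: r_def divide_simps)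
    finally have small: "(\<Sum>k\<in>UNIV. \<bar>h k\<bar> * (norm (M k) * K)) < 1" .
    obtain S where S:
      "((\<lambda>w. prod_list (map h w) *\<^sub>R foldr (\<lambda>k X. M k ** X) w B) has_sum S) UNIV"
      "S = B + (\<Sum>k\<in>UNIV. h k *\<^sub>R (M k ** S))"
      using matrix_Neumann_words[OF K(2,1) small] by blast
    interpret bb: bounded_bilinear "(**) :: real^'k^'k \<Rightarrow> real^'k^'k \<Rightarrow> real^'k^'k"
      by (rule bounded_bilinear_matrix_mult)
    have "x - a = (\<Sum>k\<in>UNIV. h k *\<^sub>R axis k 1)"
      using basis_expansion[of "x - a"] by (simp add: h_def scalar_mult_eq_scaleR)
    then have Dh: "D (x - a) = (\<Sum>k\<in>UNIV. h k *\<^sub>R D (axis k 1))"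
      by (simp add: linear_sum[OF D] linear_scale[OF D])
    have "(\<Sum>k\<in>UNIV. h k *\<^sub>R (M k ** S)) = - (B ** (D (x - a) ** S))"
      by (simp add: Dh M_def bb.sum_left bb.sum_right bb.scaleR_left bb.scaleR_right bb.minus_left
          bb.minus_right sum_negf matrix_mul_assoc)
    then have S2: "S = B - B ** (D (x - a) ** S)" using S(2) by simp
    \<comment> \<open>Multiplying the fixed-point equation by \<open>C\<^sub>0 + D a\<close>
      exhibits \<open>S\<close> as a right inverse of \<open>C\<^sub>0 + D x\<close>, which is
      enough for square matrices.\<close>
    have "(C\<^sub>0 + D a) ** S = (C\<^sub>0 + D a) ** B - ((C\<^sub>0 + D a) ** B) ** (D (x - a) ** S)"
      by (subst S2) (simp add: bb.diff_right matrix_mul_assoc)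
    also have "\<dots> = mat 1 - D (x - a) ** S"
      using inv by (simp add: B_def matrix_mul_inv)
    finally have "(C\<^sub>0 + D a + D (x - a)) ** S = mat 1" by (simp add: bb.add_left)
    moreover have "C\<^sub>0 + D a + D (x - a) = C\<^sub>0 + D x" by (simp add: linear_diff[OF D])
    ultimately have "matrix_inv (C\<^sub>0 + D x) = S" by (simp add: matrix_inv_unique)
    then show ?thesis
      using has_sum_words_to_multi_indices[OF S(1)] by (simp add: c_def h_def)
  qed
  with r show "\<exists>r>0. \<exists>c. \<forall>x\<in>ball a r.
      ((\<lambda>\<alpha>. (\<Prod>i\<in>UNIV. (x $ i - a $ i) ^ \<alpha> i) *\<^sub>R c \<alpha>) has_sum matrix_inv (C\<^sub>0 + D x)) UNIV"
    by blast
qed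

section \<open>The moment map and its inverses\<close>

text \<open>The degree is strictly increasing, hence injective, into a set of the same size. When
  \<open>CARD('m)\<close> is N - 1, exponent 0 is thus the only one below N that the component sum
  has to supply.\<close>

lemma range_moment_degree: "range (moment_degree :: 'm::{finite,linorder} \<Rightarrow> nat) = {1..CARD('m)}"
proof (rule card_subset_eq)
  have "strict_mono (moment_degree :: 'm \<Rightarrow> nat)"
    unfolding strict_mono_def moment_degree_def
  proof (intro allI impI)
    fix k l :: 'm assume "k < l"
    then have "{j. j \<le> k} \<subseteq> {j. j \<le> l}" "l \<in> {j. j \<le> l}" "l \<notin> {j. j \<le> k}" by auto
    then have "{j. j \<le> k} \<subset> {j. j \<le> l}" by blast
    then show "card {j. j \<le> k} < card {j. j \<le> l}" by (intro psubset_card_mono) auto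
  qed
  then have "inj (moment_degree :: 'm \<Rightarrow> nat)" by (rule strict_mono_imp_inj_on)
  then show "card (range (moment_degree :: 'm \<Rightarrow> nat)) = card {1..CARD('m)}"
    by (simp add: card_image)
  have "moment_degree l \<in> {1..CARD('m)}" for l :: 'm
  proof -
    have "0 < moment_degree l" unfolding moment_degree_def by (subst card_gt_0_iff) auto
    moreover have "moment_degree l \<le> CARD('m)" unfolding moment_degree_def by (rule card_mono) auto
    ultimately show ?thesis by simp
  qed
  then show "range (moment_degree :: 'm \<Rightarrow> nat) \<subseteq> {1..CARD('m)}" by blast
qed simp

text \<open>Tests \<open>v\<close> against the Lagrange polynomials of the nodes \<open>g\<^sub>1, \<dots>, g\<^sub>N\<close>.\<close>

lemma power_moments_eq_0_imp_eq_0: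
  fixes g v :: "real^'n::finite"
  assumes inj: "inj (($) g)"
    and zero: "\<And>n. n < CARD('n) \<Longrightarrow> (\<Sum>i\<in>UNIV. (g $ i) ^ n * v $ i) = 0"
  shows "v = 0"
proof -
  have poly_zero: "(\<Sum>i\<in>UNIV. poly p (g $ i) * v $ i) = 0" if "degree p < CARD('n)" for p
  proof -
    have "(\<Sum>i\<in>UNIV. poly p (g $ i) * v $ i)
        = (\<Sum>i\<in>UNIV. \<Sum>n\<le>degree p. coeff p n * ((g $ i) ^ n * v $ i))"
      by (simp add: poly_altdef sum_distrib_right mult.assoc)
    also have "\<dots> = (\<Sum>n\<le>degree p. coeff p n * (\<Sum>i\<in>UNIV. (g $ i) ^ n * v $ i))"
      by (subst sum.swap) (simp add: sum_distrib_left)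
    also have "\<dots> = 0" using zero that by (intro sum.neutral) auto
    finally show ?thesis .
  qed
  have "v $ j = 0" for j
  proof -
    define p where "p = (\<Prod>i\<in>UNIV - {j}. [:- g $ i, 1:])"
    have "degree p \<le> (\<Sum>i\<in>UNIV - {j}. degree [:- g $ i, 1:])"
      unfolding p_def by (rule order_trans[OF degree_prod_sum_le]) auto
    also have "\<dots> < CARD('n)" by (simp add: card_gt_0_iff)
    finally have 0: "(\<Sum>i\<in>UNIV. poly p (g $ i) * v $ i) = 0" by (rule poly_zero)
    have p_other: "poly p (g $ i) = 0" if "i \<noteq> j" for i
      using that unfolding p_def poly_prod by (intro prod_zero) auto
    have "(\<Sum>i\<in>UNIV. poly p (g $ i) * v $ i) = poly p (g $ j) * v $ j"
      by (subst sum.remove[of _ j]) (auto simp: p_other)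
    moreover have "poly p (g $ j) \<noteq> 0"
      using inj by (auto simp: p_def poly_prod inj_def)
    ultimately show ?thesis using 0 by simp
  qed
  then show ?thesis by (simp add: vec_eq_iff)
qed

lemma linear_moment_map: "linear (moment_map g)"
  by (rule linearI)
    (simp_all add: moment_map_def vec_eq_iff sum.distrib distrib_left sum_distrib_left mult.left_commute)

lemma subspace_zero_sum_space: "subspace zero_sum_space"
  by (simp add: subspace_def zero_sum_space_def sum.distrib flip: sum_distrib_left)

lemma dim_zero_sum_space: "dim (zero_sum_space :: (real^'n::finite) set) = CARD('n) - 1"
proof -
  have "zero_sum_space = {v :: real^'n. 1 \<bullet> v = 0}"
    by (simp add: zero_sum_space_def inner_vec_def)
  then show ?thesis using dim_hyperplane[of "1 :: real^'n"] by simp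
qed

section \<open>The moment resistance matrix\<close>

lemma linear_MS_matrix: "linear (MS_matrix f)"
  by (rule linearI)
    (auto simp: MS_matrix_def vec_eq_iff sum.distrib distrib_left distrib_right sum_distrib_left
      mult.left_commute)

text \<open>This is - L B(y) R. It is taken as a function of y on all of R^N, where it is linear;
  affine dependence on U then follows from that of y(U).\<close>

definition moment_resistance ::
    "('n \<Rightarrow> 'n \<Rightarrow> real) \<Rightarrow> real^'n::{finite,linorder} \<Rightarrow> real^'n::{finite,linorder} \<Rightarrow> real^'m::{finite,linorder}^'m::{finite,linorder}" where
  "moment_resistance f g y =
     matrix (\<lambda>w. - moment_map g (MS_matrix f y *v moment_lift g w))"

lemma linear_moment_resistance:
  "linear (moment_resistance f g :: real^'n::{finite,linorder} \<Rightarrow> real^'m::{finite,linorder}^'m::{finite,linorder})"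
  by (rule linearI)
    (simp_all add: moment_resistance_def matrix_def vec_eq_iff linear_add[OF linear_MS_matrix]
      linear_scale[OF linear_MS_matrix] linear_add[OF linear_moment_map]
      linear_scale[OF linear_moment_map] matrix_vector_mult_add_rdistrib
      flip: scaleR_matrix_vector_assoc)

section \<open>Bijectivity of the moment map on E and injectivity on the simplex\<close>

context
  fixes g :: "real^'n::{finite,linorder}" and moments :: "'m::{finite,linorder} itself"
  assumes card_moments: "CARD('m) = CARD('n) - 1"
    and inj_g: "inj (($) g)"
begin

text \<open>Equal component sums supply the moment of order 0, so all power moments of the
  difference below N vanish. This form covers both E (sum 0) and the simplex (sum 1).\<close>

lemma moment_map_eq_imp_eq:
  assumes "(moment_map g v :: (real, 'm) vec) = moment_map g v'"
    and "(\<Sum>i\<in>UNIV. v $ i) = (\<Sum>i\<in>UNIV. v' $ i)"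
  shows "v = v'"
proof -
  have "(\<Sum>i\<in>UNIV. (g $ i) ^ n * (v - v') $ i) = 0" if n: "n < CARD('n)" for n
  proof (cases "n = 0")
    case True
    then show ?thesis using assms(2) by (simp add: sum_subtractf)
  next
    case False
    then have "n \<in> range (moment_degree :: 'm \<Rightarrow> nat)"
      using n unfolding range_moment_degree card_moments by auto
    then obtain l :: 'm where l: "n = moment_degree l" by blast
    have "(moment_map g v :: (real, 'm) vec) $ l = moment_map g v' $ l" using assms(1) by simp
    then show ?thesis by (simp add: moment_map_def l sum_subtractf right_diff_distrib)
  qed
  then have "v - v' = 0" by (rule power_moments_eq_0_imp_eq_0[OF inj_g])
  then show ?thesis by simp
qed

lemma inj_on_moment_map: "inj_on (moment_map g :: (real, 'n) vec \<Rightarrow> (real, 'm) vec) zero_sum_space"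
  by (rule inj_onI) (auto simp: zero_sum_space_def intro: moment_map_eq_imp_eq)

text \<open>The map is injective on E, whose dimension N - 1 is that of the target.\<close>

lemma moment_map_image_zero_sum_space:
  "moment_map g ` zero_sum_space = (UNIV :: ((real, 'm) vec) set)"
proof -
  have span: "span zero_sum_space = (zero_sum_space :: ((real, 'n) vec) set)"
    using subspace_zero_sum_space by (simp add: span_eq_iff)
  have "dim (moment_map g ` zero_sum_space :: ((real, 'm) vec) set) = dim (UNIV :: ((real, 'm) vec) set)"
    using dim_image_eq[OF linear_moment_map, of g zero_sum_space, unfolded span, OF inj_on_moment_map]
    by (simp add: dim_zero_sum_space card_moments)
  then have "span (moment_map g ` zero_sum_space :: ((real, 'm) vec) set) = UNIV"
    using dim_eq_full by (metis dim_UNIV)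
  then show ?thesis
    using linear_subspace_image[OF linear_moment_map subspace_zero_sum_space] by (metis span_eq_iff)
qed

lemma moment_lift_moment_map:
  "v \<in> zero_sum_space \<Longrightarrow> moment_lift g (moment_map g v :: (real, 'm) vec) = v"
  unfolding moment_lift_def by (rule the_inv_into_f_f[OF inj_on_moment_map])

lemma
  fixes w :: "(real, 'm) vec"
  shows moment_map_moment_lift: "moment_map g (moment_lift g w) = w"
    and moment_lift_in_zero_sum_space: "moment_lift g w \<in> zero_sum_space"
proof -
  have "w \<in> moment_map g ` zero_sum_space" by (simp add: moment_map_image_zero_sum_space)
  then show "moment_map g (moment_lift g w) = w" and "moment_lift g w \<in> zero_sum_space"
    by (auto simp: moment_lift_moment_map)
qed

lemma linear_moment_lift: "linear (moment_lift g :: (real, 'm) vec \<Rightarrow> (real, 'n) vec)"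
proof (rule linearI)
  fix a b :: "(real, 'm) vec" and c :: real
  let ?R = "moment_lift g :: (real, 'm) vec \<Rightarrow> (real, 'n) vec"
  have "?R (moment_map g (?R a + ?R b)) = ?R a + ?R b"
    by (intro moment_lift_moment_map subspace_add subspace_zero_sum_space moment_lift_in_zero_sum_space)
  then show "?R (a + b) = ?R a + ?R b"
    by (simp add: linear_add[OF linear_moment_map] moment_map_moment_lift)
  have "?R (moment_map g (c *\<^sub>R ?R a)) = c *\<^sub>R ?R a"
    by (intro moment_lift_moment_map subspace_scale subspace_zero_sum_space moment_lift_in_zero_sum_space)
  then show "?R (c *\<^sub>R a) = c *\<^sub>R ?R a"
    by (simp add: linear_scale[OF linear_moment_map] moment_map_moment_lift)
qed

text \<open>\<open>matrix\<close> represents a map only if the map is linear, so linearity of the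
  composite - L B R is what has to be checked.\<close>

lemma moment_resistance_mult:
  "moment_resistance f g y *v w
     = - moment_map g (MS_matrix f y *v moment_lift g (w :: (real, 'm) vec))"
proof -
  have "linear (\<lambda>w :: (real, 'm) vec. - (moment_map g (MS_matrix f y *v moment_lift g w) :: (real, 'm) vec))"
    by (rule linearI)
      (simp_all add: linear_add[OF linear_moment_lift]
        linear_scale[OF linear_moment_lift] linear_add[OF linear_moment_map]
        linear_scale[OF linear_moment_map] matrix_vector_right_distrib matrix_vector_mult_scaleR)
  then show ?thesis
    unfolding moment_resistance_def by (metis matrix_vector_mul)
qed

lemma composition_of_moments_moment_map:
  assumes "y \<in> closed_composition_simplex"
  shows "composition_of_moments g (moment_map g y :: (real, 'm) vec) = y"
  unfolding composition_of_moments_def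
proof (rule the_inv_into_f_f[OF inj_onI assms])
  fix u v :: "(real, 'n) vec"
  assume "u \<in> closed_composition_simplex" "v \<in> closed_composition_simplex"
    "(moment_map g u :: (real, 'm) vec) = moment_map g v"
  then show "u = v"
    by (intro moment_map_eq_imp_eq) (auto simp: closed_composition_simplex_def)
qed

end

section \<open>The composition simplex and its moments\<close>

lemma weighted_mean_pos:
  assumes "y \<in> closed_composition_simplex" and "\<And>j. 0 < h j"
  shows "0 < (\<Sum>j\<in>UNIV. h j * y $ j)"
proof -
  have y: "\<And>j. 0 \<le> y $ j" "(\<Sum>j\<in>UNIV. y $ j) = 1"
    using assms by (auto simp: closed_composition_simplex_def)
  obtain j where "y $ j \<noteq> 0"
    using y(2) by (metis sum.neutral zero_neq_one)
  with y(1)[of j] have "0 < y $ j" by simp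
  then show ?thesis
    using assms(2) y(1) by (intro sum_pos2[of _ j]) (auto simp: less_imp_le)
qed

lemma convex_closed_composition_simplex: "convex closed_composition_simplex"
proof (rule convexI)
  fix u v :: "real^'n" and a b :: real
  assume uv: "u \<in> closed_composition_simplex" "v \<in> closed_composition_simplex"
    and ab: "0 \<le> a" "0 \<le> b" "a + b = 1"
  have "a * u $ i + b * v $ i \<le> 1" for i
    using uv ab convex_bound_le[of "u $ i" 1 "v $ i" a b]
    by (auto simp: closed_composition_simplex_def)
  with uv ab show "a *\<^sub>R u + b *\<^sub>R v \<in> closed_composition_simplex"
    by (auto simp: closed_composition_simplex_def sum.distrib simp flip: sum_distrib_left)
qed

text \<open>The vertices are the moments of the unit vectors, and a linear image of the convex
  composition simplex is convex. Every point of T is thus the moment vector of a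
  composition.\<close>

lemma moment_simplex_subset: "moment_simplex g \<subseteq> moment_map g ` closed_composition_simplex"
  unfolding moment_simplex_def
proof (rule hull_minimal)
  show "range (\<lambda>i. \<chi> l. (g $ i) ^ moment_degree l) \<subseteq> moment_map g ` closed_composition_simplex"
  proof (rule image_subsetI)
    fix i
    have "(\<chi> l. (g $ i) ^ moment_degree l) = moment_map g (axis i 1)"
      by (simp add: moment_map_def vec_eq_iff axis_def if_distrib cong: if_cong)
    moreover have "axis i 1 \<in> closed_composition_simplex"
      by (simp add: closed_composition_simplex_def axis_def)
    ultimately show "(\<chi> l. (g $ i) ^ moment_degree l) \<in> moment_map g ` closed_composition_simplex"
      by (rule image_eqI)
  qed
  show "convex (moment_map g ` closed_composition_simplex)"
    by (intro convex_linear_image linear_moment_map convex_closed_composition_simplex)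
qed

section \<open>Inversion of the Maxwell--Stefan matrix\<close>

context
  fixes g :: "real^'n::{finite,linorder}" and f :: "'n \<Rightarrow> 'n \<Rightarrow> real"
  assumes g_pos: "\<And>i. 0 < g $ i"
    and f_eq: "\<And>i j. i \<noteq> j \<Longrightarrow> f i j = g $ i + g $ j"
begin

text \<open>The summand for \<open>j = i\<close> of \<open>\<Sum>\<^sub>j f\<^sub>i\<^sub>j (y\<^sub>i v\<^sub>j - y\<^sub>j v\<^sub>i)\<close> vanishes, so \<open>f\<^sub>i\<^sub>j = g\<^sub>i + g\<^sub>j\<close> may be used
  for all \<open>j\<close>: \<open>B(y)\<close> is a diagonal matrix plus a matrix of rank two.\<close>

lemma MS_matrix_mult_nth:
  "(MS_matrix f y *v v) $ i
     = y $ i * (g $ i * (\<Sum>j\<in>UNIV. v $ j) + (\<Sum>j\<in>UNIV. g $ j * v $ j))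
       - v $ i * (g $ i * (\<Sum>j\<in>UNIV. y $ j) + (\<Sum>j\<in>UNIV. g $ j * y $ j))"
proof -
  have "(MS_matrix f y *v v) $ i
      = MS_matrix f y $ i $ i * v $ i + (\<Sum>j\<in>UNIV - {i}. MS_matrix f y $ i $ j * v $ j)"
    unfolding matrix_vector_mult_def vec_lambda_beta by (rule sum.remove) auto
  also have "\<dots> = (\<Sum>j\<in>UNIV - {i}. (g $ i + g $ j) * (y $ i * v $ j - y $ j * v $ i))"
    by (simp add: MS_matrix_def f_eq algebra_simps sum_distrib_left sum_subtractf sum.distrib)
  also have "\<dots> = (\<Sum>j\<in>UNIV. (g $ i + g $ j) * (y $ i * v $ j - y $ j * v $ i))"
    by (subst (2) sum.remove[of _ i]) auto
  also have "\<dots> = y $ i * (g $ i * (\<Sum>j\<in>UNIV. v $ j) + (\<Sum>j\<in>UNIV. g $ j * v $ j))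
       - v $ i * (g $ i * (\<Sum>j\<in>UNIV. y $ j) + (\<Sum>j\<in>UNIV. g $ j * y $ j))"
    by (simp add: algebra_simps sum_distrib_left sum_subtractf sum.distrib)
  finally show ?thesis .
qed

text \<open>Summed over i, the two terms of \<open>MS_matrix_mult_nth\<close> become the same
  products of total sums and g-weighted sums, and cancel.\<close>

lemma MS_matrix_mult_in_zero_sum_space: "MS_matrix f y *v v \<in> zero_sum_space"
  by (simp add: zero_sum_space_def MS_matrix_mult_nth sum_subtractf sum.distrib distrib_left
      flip: sum_distrib_right mult.assoc)
    (simp add: mult.commute)

text \<open>As the components of y sum to 1 and those of v to 0, the rows reduce to
  \<open>w $ j = y $ j * q - v $ j * (g $ j + m)\<close> with q the g-weighted sum of v. Dividing by
  \<open>g $ j + m\<close> and summing to zero fixes q, so v is expressed through y and w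
  alone.\<close>

lemma MS_matrix_solution:
  assumes y: "y \<in> closed_composition_simplex" and v: "v \<in> zero_sum_space"
  defines "w \<equiv> MS_matrix f y *v v" and "m \<equiv> \<Sum>j\<in>UNIV. g $ j * y $ j"
  shows "v $ i = (y $ i * ((\<Sum>j\<in>UNIV. w $ j / (g $ j + m)) / (\<Sum>j\<in>UNIV. y $ j / (g $ j + m)))
      - w $ i) / (g $ i + m)"
proof -
  define q where "q = (\<Sum>j\<in>UNIV. g $ j * v $ j)"
  have pos: "0 < g $ j + m" for j using g_pos[of j] weighted_mean_pos[OF y, of "($) g", OF g_pos] by (simp add: m_def)
  have y1: "(\<Sum>j\<in>UNIV. y $ j) = 1" and v0: "(\<Sum>j\<in>UNIV. v $ j) = 0"
    using y v by (auto simp: closed_composition_simplex_def zero_sum_space_def)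
  have w: "w $ j = y $ j * q - v $ j * (g $ j + m)" for j
    by (simp add: w_def MS_matrix_mult_nth y1 v0 q_def m_def)
  have v_eq: "v $ j = (y $ j * q - w $ j) / (g $ j + m)" for j
    using pos[of j] by (simp add: w field_simps)
  have "0 = (\<Sum>j\<in>UNIV. (y $ j * q - w $ j) / (g $ j + m))"
    using v0 by (simp add: v_eq[symmetric])
  also have "\<dots> = q * (\<Sum>j\<in>UNIV. y $ j / (g $ j + m)) - (\<Sum>j\<in>UNIV. w $ j / (g $ j + m))"
    by (simp add: diff_divide_distrib sum_subtractf sum_distrib_left mult.commute)
  finally have "q = (\<Sum>j\<in>UNIV. w $ j / (g $ j + m)) / (\<Sum>j\<in>UNIV. y $ j / (g $ j + m))"
    using weighted_mean_pos[OF y, of "\<lambda>j. 1 / (g $ j + m)"] pos by (simp add: field_simps)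
  then show ?thesis using v_eq[of i] by simp
qed

text \<open>\<open>MS_matrix_solution\<close> recovers v from its image, which gives injectivity on
  E.\<close>

lemma MS_inverse_MS_matrix:
  assumes y: "y \<in> closed_composition_simplex" and v: "v \<in> zero_sum_space"
  shows "MS_inverse f y (MS_matrix f y *v v) = v"
  unfolding MS_inverse_def
proof (rule the_inv_into_f_f[OF inj_onI v])
  fix u v assume "u \<in> zero_sum_space" "v \<in> zero_sum_space" "MS_matrix f y *v u = MS_matrix f y *v v"
  then show "u = v" using MS_matrix_solution[OF y, of u] MS_matrix_solution[OF y, of v]
    by (simp add: vec_eq_iff)
qed

section \<open>The moment diffusion matrix and its analytic extension\<close>

context
  fixes moments :: "'m::{finite,linorder} itself"
  assumes card_moments: "CARD('m) = CARD('n) - 1"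
    and inj_g: "inj (($) g)"
begin

text \<open>The factors of - L B R are undone one by one: lifting \<open>?C *v w\<close> returns - B
  R w because B maps into E, and \<open>MS_inverse\<close> then removes B. So the operator defining
  A_N is a left inverse of \<open>?C\<close>.\<close>

lemma
  assumes y: "y \<in> closed_composition_simplex"
  shows invertible_moment_resistance: "invertible (moment_resistance f g y :: ((real, 'm) vec, 'm) vec)"
    and moment_diffusion_matrix_eq_inv:
      "moment_diffusion_matrix f g (moment_map g y :: (real, 'm) vec) = matrix_inv (moment_resistance f g y)"
proof -
  let ?C = "moment_resistance f g y :: ((real, 'm) vec, 'm) vec"
  let ?\<phi> = "\<lambda>w :: (real, 'm) vec. - moment_map g (MS_inverse f y (moment_lift g w)) :: (real, 'm) vec"
  note lift = moment_lift_moment_map[OF card_moments inj_g] linear_moment_lift[OF card_moments inj_g]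
    moment_map_moment_lift[OF card_moments inj_g] moment_lift_in_zero_sum_space[OF card_moments inj_g]
  have \<phi>C: "?\<phi> (?C *v w) = w" for w
  proof -
    have "moment_lift g (?C *v w) = - (MS_matrix f y *v moment_lift g w)"
      by (simp add: moment_resistance_mult[OF card_moments inj_g] linear_neg[OF lift(2)] lift(1)
          MS_matrix_mult_in_zero_sum_space)
    also have "\<dots> = MS_matrix f y *v (- moment_lift g w)"
      by (simp add: linear_neg[OF matrix_vector_mul_linear])
    finally have "MS_inverse f y (moment_lift g (?C *v w)) = - moment_lift g w"
      by (simp add: MS_inverse_MS_matrix[OF y] subspace_neg subspace_zero_sum_space lift(4))
    then show ?thesis by (simp add: linear_neg[OF linear_moment_map] lift(3))
  qed
  then have "inj ((*v) ?C)" by (metis injI)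
  then show inv: "invertible ?C"
    using invertible_left_inverse matrix_left_invertible_injective by blast
  \<comment> \<open>Evaluating the left-inverse identity at the preimage of \<open>w\<close>
    identifies \<open>?\<phi>\<close> with the inverse matrix; its linearity comes for free.\<close>
  have "?\<phi> w = matrix_inv ?C *v w" for w
    using \<phi>C[of "matrix_inv ?C *v w"] inv by (simp add: matrix_vector_mul_assoc matrix_mul_inv)
  then show "moment_diffusion_matrix f g (moment_map g y :: (real, 'm) vec) = matrix_inv ?C"
    by (simp add: moment_diffusion_matrix_def
        composition_of_moments_moment_map[OF card_moments inj_g y])
qed

text \<open>On T, y(U) = (e - R L e) + R U for any e with component sum 1; a vertex of the simplex
  is chosen. The resistance becomes the affine function \<open>C\<^sub>0 + D V\<close>, defined for
  all \<open>V\<close>, and its inverse on the open set \<open>W\<close> of invertibility is the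
  extension.\<close>

lemma moment_diffusion_matrix_analytic_extension:
  "\<exists>W A'. open W \<and> (moment_simplex g :: ((real, 'm) vec) set) \<subseteq> W \<and> real_analytic_on A' W
     \<and> (\<forall>V\<in>moment_simplex g. A' V = moment_diffusion_matrix f g V) \<and> (\<forall>V\<in>W. invertible (A' V))"
proof -
  fix i\<^sub>0 :: 'n
  define e :: "(real, 'n) vec" where "e = axis i\<^sub>0 1"
  define C\<^sub>0 :: "((real, 'm) vec, 'm) vec" where "C\<^sub>0 = moment_resistance f g (e - moment_lift g (moment_map g e :: (real, 'm) vec))"
  define D :: "(real, 'm) vec \<Rightarrow> ((real, 'm) vec, 'm) vec" where "D V = moment_resistance f g (moment_lift g V)" for V
  define W where "W = {V. invertible (C\<^sub>0 + D V)}"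
  have D: "linear D"
    using linear_compose[OF linear_moment_lift[OF card_moments inj_g] linear_moment_resistance]
    by (simp add: D_def[abs_def] o_def)
  have C: "C\<^sub>0 + D (moment_map g y) = moment_resistance f g y"
    if y: "y \<in> closed_composition_simplex" for y
  proof -
    have "y - e \<in> zero_sum_space"
      using y by (simp add: closed_composition_simplex_def zero_sum_space_def e_def axis_def sum_subtractf)
    then have "moment_lift g (moment_map g (y - e) :: (real, 'm) vec) = y - e"
      by (rule moment_lift_moment_map[OF card_moments inj_g])
    then have "e - moment_lift g (moment_map g e :: (real, 'm) vec) + moment_lift g (moment_map g y :: (real, 'm) vec) = y"
      by (simp add: linear_diff[OF linear_moment_map]
          linear_diff[OF linear_moment_lift[OF card_moments inj_g]] algebra_simps)
    then show ?thesis
      by (simp add: C\<^sub>0_def D_def flip: linear_add[OF linear_moment_resistance])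
  qed
  have "continuous_on UNIV (\<lambda>V. det (C\<^sub>0 + D V))"
    unfolding det_def
    by (intro continuous_intros linear_continuous_on D[unfolded linear_conv_bounded_linear])
  then have "open W"
    unfolding W_def invertible_det_nz by (intro open_Collect_neq continuous_on_const)
  moreover have "moment_simplex g \<subseteq> W"
    using moment_simplex_subset[of g] C invertible_moment_resistance by (fastforce simp: W_def)
  moreover have "real_analytic_on (\<lambda>V. matrix_inv (C\<^sub>0 + D V)) W"
    unfolding W_def by (rule real_analytic_on_matrix_inv_affine[OF D])
  moreover have "matrix_inv (C\<^sub>0 + D V) = moment_diffusion_matrix f g V" if "V \<in> moment_simplex g" for V
    using that moment_simplex_subset[of g] C moment_diffusion_matrix_eq_inv by fastforce
  moreover have "invertible (matrix_inv (C\<^sub>0 + D V))" if "V \<in> W" for V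
    using that matrix_mul_inv unfolding W_def invertible_def by blast
  ultimately show ?thesis by blast
qed

end

end

section \<open>Fluxes and divergences\<close>

text \<open>The field is the sum of its components placed back on the axes. Used twice, for rows and
  then for entries, this reduces matrix fields to scalar functions.\<close>

lemma differentiable_cart:
  fixes f :: "'a::real_normed_vector \<Rightarrow> ('b::euclidean_space)^'n"
  assumes "\<And>i. (\<lambda>z. f z $ i) differentiable F"
  shows "f differentiable F"
proof -
  have "linear (axis i :: 'b \<Rightarrow> 'b^'n)" for i
    by (rule linearI) (auto simp: axis_def vec_eq_iff)
  then have "(\<lambda>z. axis i (f z $ i)) differentiable F" for i
    using assms[of i] bounded_linear.has_derivative
    unfolding differentiable_def linear_conv_bounded_linear by blast
  then have "(\<lambda>z. \<Sum>i\<in>UNIV. axis i (f z $ i)) differentiable F"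
    by (intro differentiable_sum) auto
  moreover have "f = (\<lambda>z. \<Sum>i\<in>UNIV. axis i (f z $ i))"
    by (auto simp: fun_eq_iff vec_eq_iff axis_def)
  ultimately show ?thesis by simp
qed

lemma differentiable_nth:
  "f differentiable F \<Longrightarrow> (\<lambda>z. f z $ i) differentiable F"
  unfolding differentiable_def using bounded_linear.has_derivative[OF bounded_linear_vec_nth] by blast

lemma jacobian_unique:
  "(f has_derivative f') (at x) \<Longrightarrow> jacobian f (at x) = matrix f'"
  unfolding jacobian_def by (metis frechet_derivative_at)

lemma divergence_eq:
  "(V has_derivative V') (at x) \<Longrightarrow> divergence V x = (\<Sum>k\<in>UNIV. V' (axis k 1) $ k)"
  by (simp add: divergence_def jacobian_unique trace_def matrix_def)

section \<open>The moment flux law and its divergence\<close>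

lemma moment_flux_mult: "moment_flux g J *v h = moment_map g (J *v h)"
  by (simp add: vec_eq_iff moment_flux_def moment_map_def matrix_vector_mult_def sum_distrib_left
      sum_distrib_right mult.assoc) (subst sum.swap, simp)

text \<open>Zero total flux puts every \<open>J *v h\<close> in E, so R recovers it from its moments
  \<open>moment_flux g J *v h\<close>. This turns L B J into - C F, and C is then inverted.\<close>

lemma moment_flux_eq:
  fixes g :: "real^'n::{finite,linorder}" and f :: "'n \<Rightarrow> 'n \<Rightarrow> real"
    and y :: "real^'d \<Rightarrow> real^'n::{finite,linorder}" and J :: "real^'d::finite^'n::{finite,linorder}"
  defines "U \<equiv> \<lambda>x. moment_map g (y x) :: real^'m::{finite,linorder}"
  assumes card_moments: "CARD('m) = CARD('n) - 1"
    and inj_g: "inj (($) g)"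
    and g_pos: "\<And>i. 0 < g $ i"
    and f_eq: "\<And>i j. i \<noteq> j \<Longrightarrow> f i j = g $ i + g $ j"
    and y_simplex: "y x \<in> closed_composition_simplex"
    and y_diff: "y differentiable (at x)"
    and J_sum: "(\<Sum>i\<in>UNIV. J $ i) = 0"
    and constitutive: "jacobian y (at x) = MS_matrix f (y x) ** J"
  shows "moment_flux g J = - (moment_diffusion_matrix f g (U x) ** jacobian U (at x))"
proof -
  let ?C = "moment_resistance f g (y x) :: ((real, 'm) vec, 'm) vec"
  have "(y has_derivative (\<lambda>h. (MS_matrix f (y x) ** J) *v h)) (at x)"
    using y_diff unfolding jacobian_works constitutive .
  then have dU: "(U has_derivative (\<lambda>h. moment_map g ((MS_matrix f (y x) ** J) *v h))) (at x)"
    unfolding U_def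
    by (rule bounded_linear.has_derivative[OF linear_moment_map[unfolded linear_conv_bounded_linear]])
  have "jacobian U (at x) *v h = - (?C ** moment_flux g J) *v h" for h
  proof -
    have "(\<Sum>i\<in>UNIV. (J *v h) $ i) = (\<Sum>k\<in>UNIV. (\<Sum>i\<in>UNIV. J $ i) $ k * h $ k)"
      by (simp add: matrix_vector_mult_def sum_distrib_right) (rule sum.swap)
    then have "J *v h \<in> zero_sum_space" by (simp add: zero_sum_space_def J_sum)
    then have lift: "moment_lift g (moment_map g (J *v h) :: (real, 'm) vec) = J *v h"
      by (rule moment_lift_moment_map[OF card_moments inj_g])
    have "jacobian U (at x) *v h = moment_map g ((MS_matrix f (y x) ** J) *v h)"
      unfolding jacobian_unique[OF dU]
      using fun_cong[OF matrix_vector_mul(2)[OF has_derivative_linear[OF dU]], of h] .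
    also have "\<dots> = - (?C *v (moment_flux g J *v h))"
      by (simp add: moment_flux_mult moment_resistance_mult[OF card_moments inj_g] lift
          matrix_vector_mul_assoc)
    also have "\<dots> = - (?C ** moment_flux g J) *v h"
      by (simp add: matrix_vector_mul_assoc) (simp add: matrix_vector_mult_def vec_eq_iff sum_negf)
    finally show ?thesis .
  qed
  then have "jacobian U (at x) = - (?C ** moment_flux g J)"
    by (simp add: matrix_eq)
  then have "moment_diffusion_matrix f g (U x) ** jacobian U (at x)
      = - (matrix_inv ?C ** (?C ** moment_flux g J))"
    by (simp add: U_def moment_diffusion_matrix_eq_inv[OF g_pos f_eq card_moments inj_g y_simplex]
        bounded_bilinear.minus_right[OF bounded_bilinear_matrix_mult])
  also have "matrix_inv ?C ** (?C ** moment_flux g J) = (matrix_inv ?C ** ?C) ** moment_flux g J"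
    by (rule matrix_mul_assoc)
  also have "matrix_inv ?C ** ?C = mat 1"
    by (intro matrix_mul_inv(2) invertible_moment_resistance g_pos f_eq card_moments inj_g y_simplex)
  finally show ?thesis by simp
qed

text \<open>The constitutive law determines \<open>J\<close> as a rational function of \<open>y\<close> and \<open>\<nabla>y\<close>.\<close>

lemma flux_differentiable:
  fixes g :: "real^'n::{finite,linorder}" and f :: "'n \<Rightarrow> 'n \<Rightarrow> real"
    and y :: "real^'d \<Rightarrow> real^'n::{finite,linorder}"
    and J :: "real^'d::finite \<Rightarrow> real^'d::finite^'n::{finite,linorder}"
  assumes g_pos: "\<And>i. 0 < g $ i"
    and f_eq: "\<And>i j. i \<noteq> j \<Longrightarrow> f i j = g $ i + g $ j"
    and \<Omega>: "open \<Omega>" "x \<in> \<Omega>"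
    and y_simplex: "\<And>x. x \<in> \<Omega> \<Longrightarrow> y x \<in> closed_composition_simplex"
    and y_diff: "y differentiable (at x)"
    and J_sum: "\<And>x. x \<in> \<Omega> \<Longrightarrow> (\<Sum>i\<in>UNIV. J x $ i) = 0"
    and constitutive: "\<And>x. x \<in> \<Omega> \<Longrightarrow> jacobian y (at x) = MS_matrix f (y x) ** J x"
    and grad_diff: "(\<lambda>z. jacobian y (at z)) differentiable (at x)"
  shows "J differentiable (at x)"
proof (intro differentiable_cart)
  fix i k
  let ?w = "\<lambda>j z. jacobian y (at z) $ j $ k" and ?m = "\<lambda>z. \<Sum>j\<in>UNIV. g $ j * y z $ j"
  \<comment> \<open>This is the formula of \<open>MS_matrix_solution\<close> for the k-th column of
    \<open>J z\<close>, whose image under B is the k-th column of the Jacobian of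
    \<open>y\<close>.\<close>
  let ?R = "\<lambda>z. (y z $ i * ((\<Sum>j\<in>UNIV. ?w j z / (g $ j + ?m z))
      / (\<Sum>j\<in>UNIV. y z $ j / (g $ j + ?m z))) - ?w i z) / (g $ i + ?m z)"
  have col: "(column k (M ** N)) = M *v column k N" for M :: "((real, 'n) vec, 'n) vec" and N :: "((real, 'd) vec, 'n) vec"
    by (simp add: column_def matrix_matrix_mult_def matrix_vector_mult_def)
  have eq: "?R z = J z $ i $ k" if z: "z \<in> \<Omega>" for z
  proof -
    have "(\<Sum>i\<in>UNIV. J z $ i) $ k = 0" using J_sum[OF z] by simp
    then have E: "column k (J z) \<in> zero_sum_space" by (simp add: zero_sum_space_def column_def)
    have w: "?w j z = (MS_matrix f (y z) *v column k (J z)) $ j" for j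
      unfolding constitutive[OF z] col[symmetric] by (simp add: column_def)
    show ?thesis
      using MS_matrix_solution[OF g_pos f_eq y_simplex[OF z] E, of i, symmetric]
      unfolding w by (simp add: column_def)
  qed
  have y_nth: "(\<lambda>z. y z $ j) differentiable (at x)" for j by (rule differentiable_nth[OF y_diff])
  have w_nth: "?w j differentiable (at x)" for j by (intro differentiable_nth grad_diff)
  have m: "(\<lambda>z. g $ j + ?m z) differentiable (at x)" for j
    by (intro differentiable_add differentiable_const differentiable_sum ballI differentiable_mult y_nth) auto
  have pos: "g $ j + ?m x \<noteq> 0" for j
    using g_pos[of j] weighted_mean_pos[OF y_simplex[OF \<Omega>(2)], of "($) g", OF g_pos] by linarith
  have pos': "(\<Sum>j\<in>UNIV. y x $ j / (g $ j + ?m x)) \<noteq> 0"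
    using weighted_mean_pos[OF y_simplex[OF \<Omega>(2)], of "\<lambda>j. 1 / (g $ j + ?m x)"]
      weighted_mean_pos[OF y_simplex[OF \<Omega>(2)], of "($) g", OF g_pos] g_pos by (simp add: add_pos_pos)
  have "?R differentiable (at x)"
    by (intro differentiable_divide differentiable_diff differentiable_mult differentiable_sum ballI
        y_nth w_nth m pos pos') auto
  then obtain R' where "(?R has_derivative R') (at x)" unfolding differentiable_def ..
  \<comment> \<open>The formula is known on \<Omega>, an open neighbourhood of x, so the derivative
    carries over.\<close>
  then have "((\<lambda>z. J z $ i $ k) has_derivative R') (at x)"
    by (rule has_derivative_transform_within_open[OF _ \<Omega> eq])
  then show "(\<lambda>z. J z $ i $ k) differentiable (at x)" by (rule differentiableI)
qed

text \<open>\<open>M\<close> stands for A_N(U) \<nabla>U. Its equality with - F on an open set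
  transfers derivatives, so A_N itself is never differentiated.\<close>

lemma moment_flux_divergence:
  fixes J :: "real^'d::finite \<Rightarrow> real^'d^'n::{finite,linorder}"
    and M :: "real^'d \<Rightarrow> real^'d^'m::{finite,linorder}"
  assumes J: "J differentiable (at x)"
    and \<Omega>: "open \<Omega>" "x \<in> \<Omega>"
    and M: "\<And>z. z \<in> \<Omega> \<Longrightarrow> M z = - moment_flux g (J z)"
  shows "M differentiable (at x)"
    and "row_divergence M x = - moment_map g (\<chi> i. divergence (\<lambda>z. J z $ i) x)"
proof -
  define J' where "J' i = frechet_derivative (\<lambda>z. J z $ i) (at x)" for i
  have J': "((\<lambda>z. J z $ i) has_derivative J' i) (at x)" for i
    unfolding J'_def using frechet_derivative_works differentiable_nth[OF J] by blast
  have "((\<lambda>z. - (\<Sum>i\<in>UNIV. (g $ i) ^ moment_degree l *\<^sub>R J z $ i)) has_derivative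
      (\<lambda>h. - (\<Sum>i\<in>UNIV. (g $ i) ^ moment_degree l *\<^sub>R J' i h))) (at x)" for l :: 'm
    by (intro derivative_intros J')
  then have M': "((\<lambda>z. M z $ l) has_derivative
      (\<lambda>h. - (\<Sum>i\<in>UNIV. (g $ i) ^ moment_degree l *\<^sub>R J' i h))) (at x)" for l
    by (rule has_derivative_transform_within_open[OF _ \<Omega>]) (simp add: M moment_flux_def)
  then show "M differentiable (at x)"
    by (rule differentiable_cart[OF differentiableI])
  show "row_divergence M x = - moment_map g (\<chi> i. divergence (\<lambda>z. J z $ i) x)"
    by (simp add: vec_eq_iff row_divergence_def divergence_eq[OF M'] divergence_eq[OF J']
        moment_map_def sum_negf sum_distrib_left) (intro allI sum.swap)
qed

theorem theorem7p3:
  fixes g :: "real^'n::{finite,linorder}"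
    and f :: "'n \<Rightarrow> 'n \<Rightarrow> real"
    and I :: "real set"
    and \<Omega> :: "(real^'d::finite) set"
    and y :: "real \<Rightarrow> real^'d \<Rightarrow> real^'n::{finite,linorder}"
    and J :: "real \<Rightarrow> real^'d \<Rightarrow> real^'d^'n::{finite,linorder}"
    and U :: "real \<Rightarrow> real^'d \<Rightarrow> real^'m::{finite,linorder}"
    and F :: "real \<Rightarrow> real^'d \<Rightarrow> real^'d^'m::{finite,linorder}"
    and A :: "real^'m::{finite,linorder} \<Rightarrow> real^'m::{finite,linorder}^'m::{finite,linorder}"
  assumes N_ge_2: "CARD('n) \<ge> 2"
    and number_of_moments: "CARD('m) = CARD('n) - 1"
    and g_pos: "\<And>i. 0 < g $ i"
    and g_increasing: "strict_mono (\<lambda>i. g $ i)"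
    and f_eq: "\<And>i j. i \<noteq> j \<Longrightarrow> f i j = g $ i + g $ j"
    and open_time: "open I"
    and open_domain: "open \<Omega>"
    and y_simplex: "\<And>t x. t \<in> I \<Longrightarrow> x \<in> \<Omega> \<Longrightarrow> y t x \<in> closed_composition_simplex"
    and y_space: "\<And>t x. t \<in> I \<Longrightarrow> x \<in> \<Omega> \<Longrightarrow> y t differentiable (at x)"
    and J_sum: "\<And>t x. t \<in> I \<Longrightarrow> x \<in> \<Omega> \<Longrightarrow> (\<Sum>i\<in>UNIV. J t x $ i) = 0"
    and constitutive: "\<And>t x. t \<in> I \<Longrightarrow> x \<in> \<Omega> \<Longrightarrow>
           jacobian (y t) (at x) = MS_matrix f (y t x) ** J t x"
  defines "U \<equiv> \<lambda>t x. moment_map g (y t x)"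
    and "F \<equiv> \<lambda>t x. moment_flux g (J t x)"
    and "A \<equiv> moment_diffusion_matrix f g"
  shows "(\<forall>t\<in>I. \<forall>x\<in>\<Omega>. F t x = - (A (U t x) ** jacobian (U t) (at x)))
    \<and> ((\<forall>t\<in>I. \<forall>x\<in>\<Omega>. (\<lambda>s. y s x) differentiable (at t)
              \<and> (\<lambda>z. jacobian (y t) (at z)) differentiable (at x)) \<longrightarrow>
       (\<forall>t\<in>I. \<forall>x\<in>\<Omega>. \<forall>i. deriv (\<lambda>s. y s x $ i) t + divergence (\<lambda>z. J t z $ i) x = 0) \<longrightarrow>
       (\<forall>t\<in>I. \<forall>x\<in>\<Omega>.
           (\<lambda>s. U s x) differentiable (at t)
         \<and> U t differentiable (at x)
         \<and> (\<lambda>z. A (U t z) ** jacobian (U t) (at z)) differentiable (at x)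
         \<and> vector_derivative (\<lambda>s. U s x) (at t)
             - row_divergence (\<lambda>z. A (U t z) ** jacobian (U t) (at z)) x = 0))
    \<and> (\<exists>W A'. open W \<and> moment_simplex g \<subseteq> W \<and> real_analytic_on A' W
         \<and> (\<forall>V\<in>moment_simplex g. A' V = A V) \<and> (\<forall>V\<in>W. invertible (A' V)))"
proof -
  have inj_g: "inj (($) g)"
    using strict_mono_imp_inj_on[OF g_increasing] by simp
  have flux: "F t x = - (A (U t x) ** jacobian (U t) (at x))" if "t \<in> I" "x \<in> \<Omega>" for t x
    unfolding F_def A_def U_def
    by (rule moment_flux_eq[where y = "y t"]) (use assms that inj_g in auto)
  have flux': "A (U t z) ** jacobian (U t) (at z) = - moment_flux g (J t z)" if "t \<in> I" "z \<in> \<Omega>" for t z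
    using flux[OF that] by (simp add: F_def)
  have "(\<lambda>s. U s x) differentiable (at t) \<and> U t differentiable (at x)
      \<and> (\<lambda>z. A (U t z) ** jacobian (U t) (at z)) differentiable (at x)
      \<and> vector_derivative (\<lambda>s. U s x) (at t)
          - row_divergence (\<lambda>z. A (U t z) ** jacobian (U t) (at z)) x = 0"
    if t: "t \<in> I" and x: "x \<in> \<Omega>"
      and smooth: "(\<lambda>s. y s x) differentiable (at t)"
        "(\<lambda>z. jacobian (y t) (at z)) differentiable (at x)"
      and balance: "\<And>i. deriv (\<lambda>s. y s x $ i) t + divergence (\<lambda>z. J t z $ i) x = 0" for t x
  proof (intro conjI)
    note bl = linear_moment_map[of g, unfolded linear_conv_bounded_linear]
    \<comment> \<open>Differentiability of the flux is derived from the constitutive law and the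
      second derivatives of \<open>y\<close>, so the divergence in the balance is that of a genuine
      derivative.\<close>
    have J: "J t differentiable (at x)"
      by (rule flux_differentiable[OF g_pos f_eq open_domain x, of "y t"])
        (use t x y_simplex y_space J_sum constitutive smooth in auto)
    define y' where "y' = vector_derivative (\<lambda>s. y s x) (at t)"
    have y': "((\<lambda>s. y s x) has_vector_derivative y') (at t)"
      unfolding y'_def using smooth(1) vector_derivative_works by blast
    have "((\<lambda>s. y s x $ i) has_vector_derivative y' $ i) (at t)" for i
      by (rule bounded_linear.has_vector_derivative[OF bounded_linear_vec_nth y'])
    then have deriv: "deriv (\<lambda>s. y s x $ i) t = y' $ i" for i
      by (intro DERIV_imp_deriv) (simp add: has_real_derivative_iff_has_vector_derivative)
    have U': "((\<lambda>s. U s x) has_vector_derivative moment_map g y') (at t)"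
      unfolding U_def by (rule bounded_linear.has_vector_derivative[OF bl y'])
    then show "(\<lambda>s. U s x) differentiable (at t)"
      by (auto simp: has_vector_derivative_def differentiable_def)
    show "U t differentiable (at x)"
      unfolding U_def using y_space[OF t x] bounded_linear.has_derivative[OF bl]
      by (fastforce simp: differentiable_def)
    note div = moment_flux_divergence[OF J open_domain x flux'[OF t]]
    show "(\<lambda>z. A (U t z) ** jacobian (U t) (at z)) differentiable (at x)"
      by (rule div(1))
    \<comment> \<open>The field under the divergence is - F, so subtracting its divergence adds the
      moments of the species divergences.\<close>
    have "vector_derivative (\<lambda>s. U s x) (at t)
        - row_divergence (\<lambda>z. A (U t z) ** jacobian (U t) (at z)) x
        = moment_map g y' + moment_map g (\<chi> i. divergence (\<lambda>z. J t z $ i) x)"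
      using vector_derivative_at[OF U'] div(2) by simp
    also have "\<dots> = moment_map g (y' + (\<chi> i. divergence (\<lambda>z. J t z $ i) x))"
      by (rule linear_add[OF linear_moment_map, symmetric])
    also have "y' + (\<chi> i. divergence (\<lambda>z. J t z $ i) x) = 0"
      using balance by (simp add: vec_eq_iff deriv)
    also have "moment_map g 0 = 0"
      by (rule linear_0[OF linear_moment_map])
    finally show "vector_derivative (\<lambda>s. U s x) (at t)
        - row_divergence (\<lambda>z. A (U t z) ** jacobian (U t) (at z)) x = 0" .
  qed
  moreover have "\<exists>W A'. open W \<and> moment_simplex g \<subseteq> W \<and> real_analytic_on A' W
         \<and> (\<forall>V\<in>moment_simplex g. A' V = A V) \<and> (\<forall>V\<in>W. invertible (A' V))"
    unfolding A_def
    by (rule moment_diffusion_matrix_analytic_extension[OF g_pos f_eq number_of_moments inj_g])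
  ultimately show ?thesis using flux by blast
qed

end
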